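(* Let $\Gamma$ be a locally finite connected graph and let $\{\xi_i\}_{i=1}^\infty$ be a sequence of i.i.d. random $\Gamma$-elements. If the weight function $M_{\xi_1}$ is totally defined, then there exists a constant $C=C(\Gamma,\xi_1)>0$ such that for every $n\ge 1$ $$\mathbf{P}\bigl(\mathbb{S}(\xi_1,\dots,\xi_n)\not\subseteq\mathbb{E}(\xi_1)\bigr)\le\frac{C}{n}.$$
   Context: Let $(\Omega,\mathcal{F},\mathbf{P})$ be a probability space and let $d$ be the graph distance on $V(\Gamma)$. A random $\Gamma$-element is a measurable function $\xi:\Omega\to V(\Gamma)$ (with $V(\Gamma)$ discrete); its distribution is $\mu_\xi(v)=\mathbf{P}(\xi=v)$. The weight function is $M_\xi(v)=\sum_{s\in V(\Gamma)}d^2(v,s)\mu_\xi(s)$; it is totally defined if $M_\xi(v)<\infty$ for all $v\in V(\Gamma)$. In that case the mean-set of $\xi$ is $\mathbb{E}(\xi)=\{v\in V(\Gamma)\mid M_\xi(v)\le M_\xi(u)\ \forall u\in V(\Gamma)\}$. For a sample $\xi_1,\dots,\xi_n$ put $\mu_n(u)=\frac1n|\{i\mid 1\le i\le n,\ \xi_i=u\}|$ and $M_n(v)=\sum_{s\in V(\Gamma)}d^2(v,s)\mu_n(s)$. The sample mean-set is $\mathbb{S}(\xi_1,\dots,\xi_n)=\{v\in V(\Gamma)\mid M_n(v)\le M_n(u)\ \forall u\in V(\Gamma)\}$. *)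

theory Defs
  imports "HOL-Probability.Probability" "Graph_Theory.Shortest_Path" "Graph_Theory.Digraph_Component"
begin

text \<open>
  An undirected graph is represented by a symmetric digraph: an edge between \<open>u\<close> and \<open>v\<close>
  is a pair of opposite arcs. Loops and multiple edges are not excluded; they do not affect
  the distance. Vertex and arc sets may be infinite.
\<close>

definition locally_finite :: "('a, 'b) pre_digraph \<Rightarrow> bool" where
  "locally_finite G \<longleftrightarrow> (\<forall>v\<in>verts G. finite (out_arcs G v))"

text \<open>
  With unit arc weights the cost of a walk is its length. The value between vertices not joined
  by a walk is junk (0); all uses are for connected graphs.
\<close>

definition graph_dist :: "('a, 'b) pre_digraph \<Rightarrow> 'a \<Rightarrow> 'a \<Rightarrow> real" where
  "graph_dist G u v = real_of_ereal (wf_digraph.\<mu> G (\<lambda>_. 1) u v)"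

definition law :: "'o measure \<Rightarrow> ('o \<Rightarrow> 'a) \<Rightarrow> 'a \<Rightarrow> real" where
  "law M X v = measure M {\<omega> \<in> space M. X \<omega> = v}"

text \<open>
  The weight is an infinite sum of nonnegative terms, taken in \<^typ>\<open>ennreal\<close>, so that it always
  exists and divergence means the value \<open>\<infinity>\<close>. The argument \<open>p\<close> is the mass function, either the
  law of a random element or the relative frequencies of a sample.
\<close>

definition weight :: "('a, 'b) pre_digraph \<Rightarrow> ('a \<Rightarrow> real) \<Rightarrow> 'a \<Rightarrow> ennreal" where
  "weight G p v = (\<Sum>\<^sub>\<infinity>s\<in>verts G. ennreal ((graph_dist G v s)\<^sup>2 * p s))"

definition totally_defined :: "('a, 'b) pre_digraph \<Rightarrow> ('a \<Rightarrow> real) \<Rightarrow> bool" where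
  "totally_defined G p \<longleftrightarrow> (\<forall>v\<in>verts G. weight G p v < \<infinity>)"

definition weight_minimizers :: "('a, 'b) pre_digraph \<Rightarrow> ('a \<Rightarrow> real) \<Rightarrow> 'a set" where
  "weight_minimizers G p = {v \<in> verts G. \<forall>u\<in>verts G. weight G p v \<le> weight G p u}"

definition mean_set :: "('a, 'b) pre_digraph \<Rightarrow> 'o measure \<Rightarrow> ('o \<Rightarrow> 'a) \<Rightarrow> 'a set" where
  "mean_set G M X = weight_minimizers G (law M X)"

text \<open>A sample of size \<open>n\<close> consists of the values \<open>x 1, \<dots>, x n\<close>.\<close>

definition sample_freq :: "nat \<Rightarrow> (nat \<Rightarrow> 'a) \<Rightarrow> 'a \<Rightarrow> real" where
  "sample_freq n x u = real (card {i \<in> {1..n}. x i = u}) / real n"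

definition sample_mean_set :: "('a, 'b) pre_digraph \<Rightarrow> nat \<Rightarrow> (nat \<Rightarrow> 'a) \<Rightarrow> 'a set" where
  "sample_mean_set G n x = weight_minimizers G (sample_freq n x)"

text \<open>Sequences are indexed from 1; the value at index 0 is irrelevant.\<close>

definition iid :: "'o measure \<Rightarrow> 'a measure \<Rightarrow> (nat \<Rightarrow> 'o \<Rightarrow> 'a) \<Rightarrow> bool" where
  "iid M N \<xi> \<longleftrightarrow> prob_space.indep_vars M (\<lambda>_. N) \<xi> {1..} \<and>
     (\<forall>i\<ge>1. distr M N (\<xi> i) = distr M N (\<xi> 1))"

end

theory Submission
  imports Defs
begin

text \<open>
  Only second moments of the distance are available, so the squared distances \<open>d\<^sup>2(v, \<xi>\<^sub>i)\<close>
  need not have a variance and Chebyshev's inequality cannot be applied to the sample weights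
  themselves. It does apply to differences of weights. Fix a vertex \<open>u\<close> of the mean-set and put
  \<open>r = d(u, v)\<close>. The triangle inequality gives
  \<open>r (r - 2 d(u, s)) \<le> d\<^sup>2(v, s) - d\<^sup>2(u, s) \<le> r (r + 2 d(u, s))\<close>,
  and the absolute value of the difference obeys the same upper bound. The differences
  thus grow only linearly in \<open>d(u, s)\<close> and have a finite second moment.

  The same lower bound reduces the infinitely many competitors \<open>v\<close> to finitely many. Averaged
  over the sample it reads \<open>M\<^sub>n(v) - M\<^sub>n(u) \<ge> r (r - 2 m)\<close>, where \<open>m\<close> is the sample mean of
  \<open>d(u, \<xi>\<^sub>i)\<close>. Unless \<open>m\<close> exceeds its expectation by at least 1, no vertex outside a fixed
  ball around \<open>u\<close> can minimise \<open>M\<^sub>n\<close>; this ball is finite by local finiteness.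
  Averaged over the law instead, the bound shows that the mean-set is nonempty, so that
  \<open>u\<close> exists.

  Hence the event that the sample mean-set leaves the mean-set is covered by finitely many events:
  the sample mean of \<open>d(u, \<xi>\<^sub>i)\<close> deviates by at least 1, or, for some \<open>v\<close> in the ball but not in
  the mean-set, the sample mean of \<open>d\<^sup>2(v, \<xi>\<^sub>i) - d\<^sup>2(u, \<xi>\<^sub>i)\<close> is at most 0 although its expectation
  is positive. Each has probability \<open>O(1/n)\<close> by \<open>iid_sample_mean_Chebyshev\<close>. The argument is
  carried by \<open>square_dist_diff_lower\<close>, \<open>square_dist_diff_bound\<close>, \<open>finite_graph_ball\<close> and
  \<open>infsum_law_eq_nn_integral\<close>, which turns weights into expectations.
\<close>

section \<open>The graph metric\<close>

locale connected_locally_finite_graph = sym_digraph G for G :: "('a, 'b) pre_digraph" +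
  assumes connected_graph: "Digraph_Component.connected G"
    and locally_finite_graph: "locally_finite G"
begin

lemma awalk_exists:
  assumes "u \<in> verts G" "v \<in> verts G"
  shows "\<exists>p. awalk u p v"
  using assms connected_graph reachable_mk_symmetric_eq[OF sym_arcs]
  by (auto simp: Digraph_Component.connected_def strongly_connected_def reachable_awalk)

lemma awalk_cost_unit: "awalk_cost (\<lambda>_. 1) p = real (length p)"
  by (induction p) auto

text \<open>
  The infimum over all walks is a minimum because lengths are natural numbers. This makes the
  distance the length of an actual walk, which can be concatenated and reversed.
\<close>

lemma graph_dist_attained:
  assumes "u \<in> verts G" "v \<in> verts G"
  obtains p where "awalk u p v" "graph_dist G u v = real (length p)"
    "\<And>q. awalk u q v \<Longrightarrow> graph_dist G u v \<le> real (length q)"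
proof -
  obtain p where p: "awalk u p v" and min: "\<And>q. awalk u q v \<Longrightarrow> length p \<le> length q"
    using awalk_exists[OF assms] ex_has_least_nat[of "\<lambda>p. awalk u p v" _ length] by blast
  have "\<mu> (\<lambda>_. 1) u v = ereal (real (length p))"
    unfolding \<mu>_def awalk_cost_unit using p min by (intro INF_eqI) auto
  then have "graph_dist G u v = real (length p)"
    by (simp add: graph_dist_def)
  with p min show thesis by (intro that) auto
qed

lemma graph_dist_le_length:
  assumes "awalk u p v"
  shows "graph_dist G u v \<le> real (length p)"
proof -
  have "u \<in> verts G" "v \<in> verts G" using assms by auto
  then show ?thesis using assms by (metis graph_dist_attained)
qed

lemma graph_dist_nonneg: "u \<in> verts G \<Longrightarrow> v \<in> verts G \<Longrightarrow> 0 \<le> graph_dist G u v"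
  by (metis graph_dist_attained of_nat_0_le_iff)

lemma graph_dist_triangle:
  assumes "u \<in> verts G" "v \<in> verts G" "w \<in> verts G"
  shows "graph_dist G u w \<le> graph_dist G u v + graph_dist G v w"
proof -
  obtain p where p: "awalk u p v" "graph_dist G u v = real (length p)"
    using graph_dist_attained[OF assms(1,2)] by metis
  obtain q where q: "awalk v q w" "graph_dist G v w = real (length q)"
    using graph_dist_attained[OF assms(2,3)] by metis
  have "awalk u (p @ q) w" using p q by (blast intro: awalk_appendI)
  from graph_dist_le_length[OF this] p q show ?thesis by simp
qed

lemma awalk_reverse:
  assumes "awalk u p v"
  shows "\<exists>q. awalk v q u \<and> length q = length p"
  using assms
proof (induction p arbitrary: u)
  case Nil
  then show ?case by (auto simp: awalk_Nil_iff)
next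
  case (Cons e p)
  then obtain q where q: "awalk v q (head G e)" "length q = length p"
    by (auto simp: awalk_Cons_iff)
  from Cons.prems have e: "e \<in> arcs G" "tail G e = u" by (auto simp: awalk_Cons_iff)
  then obtain e' where e': "e' \<in> arcs G" "tail G e' = head G e" "head G e' = u"
    using sym_arcs by (metis symmetric_conv)
  have "awalk (head G e) [e'] u"
    using arc_implies_awalk[OF e'(1)] e' by simp
  with q have "awalk v (q @ [e']) u" by (blast intro: awalk_appendI)
  with q(2) show ?case by (intro exI[of _ "q @ [e']"]) simp
qed

lemma graph_dist_commute:
  assumes "u \<in> verts G" "v \<in> verts G"
  shows "graph_dist G u v = graph_dist G v u"
proof -
  have "graph_dist G y x \<le> graph_dist G x y" if "x \<in> verts G" "y \<in> verts G" for x y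
    using graph_dist_attained[OF that] awalk_reverse graph_dist_le_length by metis
  with assms show ?thesis by (simp add: order_antisym)
qed

text \<open>
  A walk is its first arc followed by a shorter walk, and local finiteness leaves finitely many
  choices for the first arc.
\<close>

lemma finite_awalks_of_length: "finite {p. length p = n \<and> (\<exists>v. awalk u p v)}"
proof (induction n arbitrary: u)
  case 0
  have "{p :: 'b list. length p = 0 \<and> (\<exists>v. awalk u p v)} \<subseteq> {[]}" by auto
  then show ?case by (rule finite_subset) simp
next
  case (Suc n)
  have fin: "finite (out_arcs G u)"
  proof (cases "u \<in> verts G")
    case False
    then have "out_arcs G u = {}" by (auto simp: out_arcs_def)
    then show ?thesis by simp
  qed (use locally_finite_graph in \<open>simp add: locally_finite_def\<close>)
  have "{p. length p = Suc n \<and> (\<exists>v. awalk u p v)}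
      \<subseteq> (\<Union>e\<in>out_arcs G u. (#) e ` {p. length p = n \<and> (\<exists>v. awalk (head G e) p v)})"
  proof
    fix p assume "p \<in> {p. length p = Suc n \<and> (\<exists>v. awalk u p v)}"
    then obtain e q v where "p = e # q" "length q = n" "awalk u (e # q) v"
      by (auto simp: length_Suc_conv)
    then show "p \<in> (\<Union>e\<in>out_arcs G u. (#) e ` {p. length p = n \<and> (\<exists>v. awalk (head G e) p v)})"
      by (auto simp: awalk_Cons_iff out_arcs_def)
  qed
  then show ?case by (rule finite_subset) (use fin Suc.IH in auto)
qed

lemma finite_graph_ball:
  assumes "u \<in> verts G"
  shows "finite {v \<in> verts G. graph_dist G u v \<le> r}"
proof (rule finite_subset)
  let ?W = "\<Union>n\<le>nat \<lfloor>r\<rfloor>. {p. length p = n \<and> (\<exists>v. awalk u p v)}"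
  show "{v \<in> verts G. graph_dist G u v \<le> r} \<subseteq> awlast u ` ?W"
  proof
    fix v assume v: "v \<in> {v \<in> verts G. graph_dist G u v \<le> r}"
    then have "v \<in> verts G" by simp
    from graph_dist_attained[OF assms this]
    obtain p where p: "awalk u p v" "graph_dist G u v = real (length p)" .
    then have "length p \<le> nat \<lfloor>r\<rfloor>" using v by (simp add: le_nat_floor)
    then show "v \<in> awlast u ` ?W" using p by force
  qed
  show "finite (awlast u ` ?W)" using finite_awalks_of_length by auto
qed

text \<open>
  Connectedness exhausts the graph by the finite balls around one vertex. Countability is what
  allows the law on vertices to determine expectations as sums of point masses.
\<close>

lemma countable_verts: "countable (verts G)"
proof (cases "verts G = {}")
  case False
  then obtain u where u: "u \<in> verts G" by auto
  have "verts G \<subseteq> (\<Union>n::nat. {v \<in> verts G. graph_dist G u v \<le> real n})"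
    using real_arch_simple by auto
  then show ?thesis
    by (rule countable_subset) (use finite_graph_ball[OF u] in \<open>auto intro: countable_finite\<close>)
qed simp

lemma graph_dist_diff:
  assumes "u \<in> verts G" "v \<in> verts G" "s \<in> verts G"
  shows "\<bar>graph_dist G u v - graph_dist G u s\<bar> \<le> graph_dist G v s"
    and "graph_dist G v s \<le> graph_dist G u v + graph_dist G u s"
  using graph_dist_triangle[of u v s] graph_dist_triangle[of u s v] graph_dist_triangle[of v u s]
    graph_dist_commute[of u v] graph_dist_commute[of s v] assms by auto

text \<open>
  Squaring \<open>\<bar>d(u, v) - d(u, s)\<bar> \<le> d(v, s)\<close> cancels the quadratic term in \<open>d(u, s)\<close>. The bound is
  positive once \<open>v\<close> is more than twice as far from \<open>u\<close> as \<open>s\<close> is; it is used in the mean over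
  \<open>s\<close>, both for the law and for a sample, to exclude remote minimisers.
\<close>

lemma square_dist_diff_lower:
  assumes "u \<in> verts G" "v \<in> verts G" "s \<in> verts G"
  shows "graph_dist G u v * (graph_dist G u v - 2 * graph_dist G u s)
    \<le> (graph_dist G v s)\<^sup>2 - (graph_dist G u s)\<^sup>2"
proof -
  have "(graph_dist G u v - graph_dist G u s)\<^sup>2 \<le> (graph_dist G v s)\<^sup>2"
    using graph_dist_diff(1)[OF assms] by (metis abs_ge_zero power2_abs power_mono)
  then show ?thesis by (simp add: power2_eq_square algebra_simps)
qed

text \<open>
  The growth is linear in \<open>d(u, s)\<close>, so a finite second moment of the distance already gives a
  finite variance of the difference.
\<close>

lemma square_dist_diff_bound:
  assumes "u \<in> verts G" "v \<in> verts G" "s \<in> verts G"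
  shows "\<bar>(graph_dist G v s)\<^sup>2 - (graph_dist G u s)\<^sup>2\<bar>
    \<le> graph_dist G u v * (graph_dist G u v + 2 * graph_dist G u s)"
proof (rule abs_leI)
  have "(graph_dist G v s)\<^sup>2 \<le> (graph_dist G u v + graph_dist G u s)\<^sup>2"
    using graph_dist_diff(2)[OF assms] graph_dist_nonneg assms by (intro power_mono) auto
  then show "(graph_dist G v s)\<^sup>2 - (graph_dist G u s)\<^sup>2
      \<le> graph_dist G u v * (graph_dist G u v + 2 * graph_dist G u s)"
    by (simp add: power2_eq_square algebra_simps)
  have "- ((graph_dist G v s)\<^sup>2 - (graph_dist G u s)\<^sup>2)
      \<le> graph_dist G u v * (2 * graph_dist G u s - graph_dist G u v)"
    using square_dist_diff_lower[OF assms] by (simp add: algebra_simps)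
  also have "\<dots> \<le> graph_dist G u v * (graph_dist G u v + 2 * graph_dist G u s)"
    using graph_dist_nonneg assms by (intro mult_left_mono) auto
  finally show "- ((graph_dist G v s)\<^sup>2 - (graph_dist G u s)\<^sup>2)
      \<le> graph_dist G u v * (graph_dist G u v + 2 * graph_dist G u s)" .
qed

end

section \<open>Weights as expectations\<close>

text \<open>
  For a finite part \<open>F\<close> of \<open>V\<close> the sum is the integral restricted to \<open>X \<in> F\<close>. The infinite sum is
  the supremum over all finite parts, while monotone convergence needs a chain; enumerating
  \<open>V\<close> provides a chain that exhausts it, so both suprema agree with the integral.
\<close>

lemma infsum_law_eq_nn_integral:
  fixes g :: "'a \<Rightarrow> real"
  assumes "prob_space M" and X: "X \<in> measurable M (count_space V)" and V: "countable V"
    and g: "\<And>s. s \<in> V \<Longrightarrow> 0 \<le> g s"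
  shows "(\<Sum>\<^sub>\<infinity>s\<in>V. ennreal (g s * law M X s)) = (\<integral>\<^sup>+\<omega>. ennreal (g (X \<omega>)) \<partial>M)"
proof -
  interpret prob_space M by fact
  have XV: "X \<omega> \<in> V" if "\<omega> \<in> space M" for \<omega>
    using measurable_space[OF X that] by simp
  have gX: "(\<lambda>\<omega>. h (X \<omega>)) \<in> borel_measurable M" for h :: "'a \<Rightarrow> ennreal"
    using measurable_compose[OF X, of h borel] by simp
  \<comment> \<open>A finite partial sum is the integral restricted to the event that \<open>X\<close> lies in \<open>F\<close>.\<close>
  have part: "(\<Sum>s\<in>F. ennreal (g s * law M X s)) = (\<integral>\<^sup>+\<omega>. ennreal (g (X \<omega>)) * indicator F (X \<omega>) \<partial>M)"
    if F: "finite F" "F \<subseteq> V" for F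
  proof -
    have "(\<integral>\<^sup>+\<omega>. ennreal (g (X \<omega>)) * indicator F (X \<omega>) \<partial>M)
        = (\<integral>\<^sup>+\<omega>. (\<Sum>s\<in>F. ennreal (g s) * indicator {\<omega>\<in>space M. X \<omega> = s} \<omega>) \<partial>M)"
    proof (rule nn_integral_cong)
      fix \<omega> assume "\<omega> \<in> space M"
      then have "(\<Sum>s\<in>F. ennreal (g s) * indicator {\<omega>\<in>space M. X \<omega> = s} \<omega>)
        = (\<Sum>s\<in>F. if s = X \<omega> then ennreal (g s) else 0)"
        by (intro sum.cong) (auto simp: indicator_def)
      then show "ennreal (g (X \<omega>)) * indicator F (X \<omega>)
        = (\<Sum>s\<in>F. ennreal (g s) * indicator {\<omega>\<in>space M. X \<omega> = s} \<omega>)"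
        using F by (simp add: sum.delta indicator_def)
    qed
    also have "\<dots> = (\<Sum>s\<in>F. ennreal (g s) * emeasure M {\<omega>\<in>space M. X \<omega> = s})"
    proof -
      have m: "{\<omega>\<in>space M. X \<omega> = s} \<in> sets M" if "s \<in> F" for s
      proof -
        have "{\<omega>\<in>space M. X \<omega> = s} = X -` {s} \<inter> space M" by auto
        then show ?thesis using measurable_sets[OF X, of "{s}"] that F by auto
      qed
      then show ?thesis
        by (subst nn_integral_sum) (auto simp: nn_integral_cmult_indicator)
    qed
    also have "\<dots> = (\<Sum>s\<in>F. ennreal (g s * law M X s))"
      using F g by (intro sum.cong) (auto simp: law_def emeasure_eq_measure ennreal_mult)
    finally show ?thesis by simp
  qed
  define F where "F n = {s\<in>V. to_nat_on V s \<le> n}" for n :: nat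
  have finF: "finite (F n)" for n
  proof -
    have "inj_on (to_nat_on V) (F n)"
      by (rule inj_on_subset[OF inj_on_to_nat_on[OF V]]) (auto simp: F_def)
    moreover have "to_nat_on V ` F n \<subseteq> {..n}" by (auto simp: F_def)
    ultimately show ?thesis by (meson finite_atMost inj_on_finite)
  qed
  have FV: "F n \<subseteq> V" for n by (auto simp: F_def)
  have "(\<integral>\<^sup>+\<omega>. ennreal (g (X \<omega>)) \<partial>M)
      = (\<integral>\<^sup>+\<omega>. (SUP n. ennreal (g (X \<omega>)) * indicator (F n) (X \<omega>)) \<partial>M)"
  proof (rule nn_integral_cong)
    fix \<omega> assume "\<omega> \<in> space M"
    then have "X \<omega> \<in> F (to_nat_on V (X \<omega>))" using XV by (auto simp: F_def)
    then show "ennreal (g (X \<omega>)) = (SUP n. ennreal (g (X \<omega>)) * indicator (F n) (X \<omega>))"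
      by (intro antisym SUP_least SUP_upper2[of "to_nat_on V (X \<omega>)"]) (auto simp: indicator_def)
  qed
  also have "\<dots> = (SUP n. \<integral>\<^sup>+\<omega>. ennreal (g (X \<omega>)) * indicator (F n) (X \<omega>) \<partial>M)"
  proof (rule nn_integral_monotone_convergence_SUP)
    show "incseq (\<lambda>n \<omega>. ennreal (g (X \<omega>)) * indicator (F n) (X \<omega>))"
      by (auto simp: incseq_def le_fun_def F_def indicator_def)
  qed (rule gX)
  also have "\<dots> = (SUP n. \<Sum>s\<in>F n. ennreal (g s * law M X s))"
    using part[OF finF FV] by simp
  finally have int: "(\<integral>\<^sup>+\<omega>. ennreal (g (X \<omega>)) \<partial>M) = (SUP n. \<Sum>s\<in>F n. ennreal (g s * law M X s))" .
  have inf: "(\<Sum>\<^sub>\<infinity>s\<in>V. ennreal (g s * law M X s))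
      = (SUP F\<in>{F. finite F \<and> F \<subseteq> V}. \<Sum>s\<in>F. ennreal (g s * law M X s))"
    by (rule nonneg_infsum_complete) simp
  show ?thesis
  proof (rule antisym)
    show "(\<Sum>\<^sub>\<infinity>s\<in>V. ennreal (g s * law M X s)) \<le> (\<integral>\<^sup>+\<omega>. ennreal (g (X \<omega>)) \<partial>M)"
      unfolding inf
      by (intro SUP_least) (auto simp: part indicator_def intro!: nn_integral_mono)
    show "(\<integral>\<^sup>+\<omega>. ennreal (g (X \<omega>)) \<partial>M) \<le> (\<Sum>\<^sub>\<infinity>s\<in>V. ennreal (g s * law M X s))"
      unfolding inf int by (intro SUP_least SUP_upper) (use finF FV in auto)
  qed
qed

text \<open>
  The frequencies vanish off the sample, so the infinite sum is a finite one; grouping the sample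
  points by their value turns it into a sample mean.
\<close>

lemma weight_sample_freq:
  assumes x: "\<And>i. i \<in> {1..n} \<Longrightarrow> x i \<in> verts G"
  shows "weight G (sample_freq n x) v = ennreal ((\<Sum>i=1..n. (graph_dist G v (x i))\<^sup>2) / real n)"
proof -
  let ?g = "\<lambda>s. (graph_dist G v s)\<^sup>2"
  have supp: "sample_freq n x s = 0" if "s \<notin> x ` {1..n}" for s
  proof -
    have "{i \<in> {1..n}. x i = s} = {}" using that by auto
    then show ?thesis by (simp only: sample_freq_def) simp
  qed
  have "weight G (sample_freq n x) v = (\<Sum>\<^sub>\<infinity>s\<in>x ` {1..n}. ennreal (?g s * sample_freq n x s))"
    unfolding weight_def using x supp by (intro infsum_cong_neutral) auto
  also have "\<dots> = (\<Sum>s\<in>x ` {1..n}. ennreal (?g s * sample_freq n x s))"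
    by (rule infsum_finite) simp
  also have "\<dots> = ennreal (\<Sum>s\<in>x ` {1..n}. ?g s * sample_freq n x s)"
    by (rule sum_ennreal) (simp add: sample_freq_def)
  also have "(\<Sum>s\<in>x ` {1..n}. ?g s * sample_freq n x s)
      = (\<Sum>s\<in>x ` {1..n}. real (card {i \<in> {1..n}. x i = s}) * ?g s) / real n"
    by (simp add: sample_freq_def sum_divide_distrib mult.commute)
  also have "\<dots> = (\<Sum>i=1..n. ?g (x i)) / real n"
    by (subst sum_fun_comp[of "{1..n}" "x ` {1..n}" x ?g]) auto
  finally show ?thesis .
qed

section \<open>The weak law with rate \<open>1/n\<close>\<close>

text \<open>
  After centring, pairwise independence kills the mixed terms of the squared sum, so its
  expectation is \<open>n\<close> times one variance. The values \<open>f (\<xi> i)\<close> inherit moments from \<open>f (\<xi> 1)\<close>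
  because they have the same law.
\<close>

lemma (in prob_space) iid_sample_mean_Chebyshev:
  fixes f :: "'b \<Rightarrow> real"
  assumes iid: "iid M N \<xi>" and f [measurable]: "f \<in> borel_measurable N"
    and sq: "integrable M (\<lambda>\<omega>. (f (\<xi> 1 \<omega>))\<^sup>2)" and n: "n \<ge> 1" and a: "a > 0"
  shows "prob {\<omega> \<in> space M. a \<le> \<bar>(\<Sum>i=1..n. f (\<xi> i \<omega>)) / real n - expectation (\<lambda>\<omega>. f (\<xi> 1 \<omega>))\<bar>}
    \<le> variance (\<lambda>\<omega>. f (\<xi> 1 \<omega>)) / a\<^sup>2 / real n"
proof -
  define m where "m = expectation (\<lambda>\<omega>. f (\<xi> 1 \<omega>))"
  define g where "g = (\<lambda>x. f x - m)"
  have g [measurable]: "g \<in> borel_measurable N"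
    unfolding g_def by (intro borel_measurable_diff f borel_measurable_const)
  have indep: "indep_vars (\<lambda>_. N) \<xi> {1..}"
    and ident: "\<And>i. i \<ge> 1 \<Longrightarrow> distr M N (\<xi> i) = distr M N (\<xi> 1)"
    using iid unfolding iid_def by blast+
  have rv: "random_variable N (\<xi> i)" if "i \<ge> 1" for i
    using indep that by (auto simp: indep_vars_def)
  note rv1 [measurable] = rv[OF order_refl]
  have same: "integrable M (\<lambda>\<omega>. h (\<xi> i \<omega>)) \<longleftrightarrow> integrable M (\<lambda>\<omega>. h (\<xi> 1 \<omega>))"
    "expectation (\<lambda>\<omega>. h (\<xi> i \<omega>)) = expectation (\<lambda>\<omega>. h (\<xi> 1 \<omega>))"
    if "i \<ge> 1" "h \<in> borel_measurable N" for i and h :: "'b \<Rightarrow> real"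
    using integrable_distr_eq[OF rv[OF that(1)] that(2)] integrable_distr_eq[OF rv1 that(2)]
      integral_distr[OF rv[OF that(1)] that(2)] integral_distr[OF rv1 that(2)] ident[OF that(1)]
    by auto
  have int1: "integrable M (\<lambda>\<omega>. f (\<xi> 1 \<omega>))"
    by (rule square_integrable_imp_integrable[OF _ sq]) measurable
  have intg1: "integrable M (\<lambda>\<omega>. g (\<xi> 1 \<omega>))" using int1 by (simp add: g_def)
  have intg1sq: "integrable M (\<lambda>\<omega>. (g (\<xi> 1 \<omega>))\<^sup>2)"
    using sq int1 by (simp add: g_def power2_diff)
  have intg: "integrable M (\<lambda>\<omega>. g (\<xi> i \<omega>))" and meang: "expectation (\<lambda>\<omega>. g (\<xi> i \<omega>)) = 0"
    and intgsq: "integrable M (\<lambda>\<omega>. (g (\<xi> i \<omega>))\<^sup>2)"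
    and varg: "expectation (\<lambda>\<omega>. (g (\<xi> i \<omega>))\<^sup>2) = variance (\<lambda>\<omega>. f (\<xi> 1 \<omega>))"
    if i: "i \<ge> 1" for i
  proof -
    show "integrable M (\<lambda>\<omega>. g (\<xi> i \<omega>))" using same(1)[OF i g] intg1 by simp
    have "expectation (\<lambda>\<omega>. g (\<xi> 1 \<omega>)) = 0"
      using int1 by (simp add: g_def prob_space m_def)
    then show "expectation (\<lambda>\<omega>. g (\<xi> i \<omega>)) = 0" using same(2)[OF i g] by simp
    have gsq: "(\<lambda>x. (g x)\<^sup>2) \<in> borel_measurable N" by simp
    show "integrable M (\<lambda>\<omega>. (g (\<xi> i \<omega>))\<^sup>2)" using same(1)[OF i gsq] intg1sq by simp
    show "expectation (\<lambda>\<omega>. (g (\<xi> i \<omega>))\<^sup>2) = variance (\<lambda>\<omega>. f (\<xi> 1 \<omega>))"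
      using same(2)[OF i gsq] by (simp add: g_def m_def)
  qed
  have cross: "integrable M (\<lambda>\<omega>. g (\<xi> i \<omega>) * g (\<xi> j \<omega>))"
    "expectation (\<lambda>\<omega>. g (\<xi> i \<omega>) * g (\<xi> j \<omega>)) = (if i = j then variance (\<lambda>\<omega>. f (\<xi> 1 \<omega>)) else 0)"
    if ij: "i \<ge> 1" "j \<ge> 1" for i j
  proof -
    have "integrable M (\<lambda>\<omega>. g (\<xi> i \<omega>) * g (\<xi> j \<omega>)) \<and>
      expectation (\<lambda>\<omega>. g (\<xi> i \<omega>) * g (\<xi> j \<omega>)) = (if i = j then variance (\<lambda>\<omega>. f (\<xi> 1 \<omega>)) else 0)"
    proof (cases "i = j")
      case True
      then show ?thesis using intgsq[OF ij(1)] varg[OF ij(1)] by (simp add: power2_eq_square)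
    next
      case False
      have iv: "indep_vars (\<lambda>_. borel) (\<lambda>k \<omega>. g (\<xi> k \<omega>)) {i, j}"
      proof (rule indep_vars_compose2[OF _ g])
        show "indep_vars (\<lambda>_. N) \<xi> {i, j}"
          by (rule indep_vars_subset[OF indep]) (use ij in simp)
      qed
      have "integrable M (\<lambda>\<omega>. \<Prod>k\<in>{i,j}. g (\<xi> k \<omega>))"
        using ij intg by (intro indep_vars_integrable[OF _ iv]) auto
      moreover have "expectation (\<lambda>\<omega>. \<Prod>k\<in>{i,j}. g (\<xi> k \<omega>)) = (\<Prod>k\<in>{i,j}. expectation (\<lambda>\<omega>. g (\<xi> k \<omega>)))"
        using ij intg by (intro indep_vars_lebesgue_integral[OF _ iv]) auto
      ultimately show ?thesis using False meang ij by simp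
    qed
    then show "integrable M (\<lambda>\<omega>. g (\<xi> i \<omega>) * g (\<xi> j \<omega>))"
      "expectation (\<lambda>\<omega>. g (\<xi> i \<omega>) * g (\<xi> j \<omega>)) = (if i = j then variance (\<lambda>\<omega>. f (\<xi> 1 \<omega>)) else 0)"
      by auto
  qed
  let ?S = "\<lambda>\<omega>. \<Sum>i=1..n. g (\<xi> i \<omega>)"
  have Ssq: "(?S \<omega>)\<^sup>2 = (\<Sum>i=1..n. \<Sum>j=1..n. g (\<xi> i \<omega>) * g (\<xi> j \<omega>))" for \<omega>
    by (simp add: power2_eq_square sum_product)
  have intS: "integrable M (\<lambda>\<omega>. (?S \<omega>)\<^sup>2)"
    unfolding Ssq by (intro Bochner_Integration.integrable_sum cross(1)) auto
  have "expectation (\<lambda>\<omega>. (?S \<omega>)\<^sup>2) = (\<Sum>i=1..n. \<Sum>j=1..n. expectation (\<lambda>\<omega>. g (\<xi> i \<omega>) * g (\<xi> j \<omega>)))"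
    unfolding Ssq
    by (subst Bochner_Integration.integral_sum; (intro Bochner_Integration.integrable_sum cross(1))?)
       (auto intro!: sum.cong Bochner_Integration.integral_sum cross(1))
  also have "\<dots> = (\<Sum>i=1..n. \<Sum>j=1..n. if i = j then variance (\<lambda>\<omega>. f (\<xi> 1 \<omega>)) else 0)"
    by (intro sum.cong refl) (use cross(2) in auto)
  also have "\<dots> = real n * variance (\<lambda>\<omega>. f (\<xi> 1 \<omega>))"
    by simp
  finally have ES: "expectation (\<lambda>\<omega>. (?S \<omega>)\<^sup>2) = real n * variance (\<lambda>\<omega>. f (\<xi> 1 \<omega>))" .
  have na: "real n * a > 0" using n a by simp
  have mS: "?S \<in> borel_measurable M"
    using rv g by (intro borel_measurable_sum) (auto intro: measurable_compose)
  have "a \<le> \<bar>(\<Sum>i=1..n. f (\<xi> i \<omega>)) / real n - m\<bar> \<longleftrightarrow> real n * a \<le> \<bar>?S \<omega>\<bar>" for \<omega>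
  proof -
    have "?S \<omega> = real n * ((\<Sum>i=1..n. f (\<xi> i \<omega>)) / real n - m)"
      using n by (simp add: g_def sum_subtractf algebra_simps)
    then have "\<bar>?S \<omega>\<bar> = real n * \<bar>(\<Sum>i=1..n. f (\<xi> i \<omega>)) / real n - m\<bar>"
      by (simp add: abs_mult)
    then show ?thesis using n by simp
  qed
  then have "prob {\<omega> \<in> space M. a \<le> \<bar>(\<Sum>i=1..n. f (\<xi> i \<omega>)) / real n - m\<bar>}
      = prob {\<omega> \<in> space M. real n * a \<le> \<bar>?S \<omega>\<bar>}" by simp
  also have "\<dots> \<le> expectation (\<lambda>\<omega>. (?S \<omega>)\<^sup>2) / (real n * a)\<^sup>2"
    by (rule second_moment_method[OF mS intS na])
  also have "\<dots> = variance (\<lambda>\<omega>. f (\<xi> 1 \<omega>)) / a\<^sup>2 / real n"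
    using n a unfolding ES by (simp add: power2_eq_square field_simps)
  finally show ?thesis by (simp add: m_def)
qed

section \<open>Concentration of the sample mean-set\<close>

context connected_locally_finite_graph
begin

lemma weight_law_eq_expectation:
  assumes "prob_space M" and X: "X \<in> measurable M (count_space (verts G))"
    and total: "totally_defined G (law M X)" and v: "v \<in> verts G"
  shows "integrable M (\<lambda>\<omega>. (graph_dist G v (X \<omega>))\<^sup>2)"
    and "weight G (law M X) v = ennreal (\<integral>\<omega>. (graph_dist G v (X \<omega>))\<^sup>2 \<partial>M)"
proof -
  have eq: "weight G (law M X) v = (\<integral>\<^sup>+\<omega>. ennreal ((graph_dist G v (X \<omega>))\<^sup>2) \<partial>M)"
    unfolding weight_def by (rule infsum_law_eq_nn_integral[OF assms(1) X countable_verts]) simp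
  have meas: "(\<lambda>\<omega>. (graph_dist G v (X \<omega>))\<^sup>2) \<in> borel_measurable M"
    by (rule measurable_compose[OF X]) simp
  show int: "integrable M (\<lambda>\<omega>. (graph_dist G v (X \<omega>))\<^sup>2)"
    using total v eq unfolding totally_defined_def
    by (intro integrableI_nonneg[OF meas]) auto
  show "weight G (law M X) v = ennreal (\<integral>\<omega>. (graph_dist G v (X \<omega>))\<^sup>2 \<partial>M)"
    unfolding eq by (rule nn_integral_eq_integral[OF int]) simp
qed

lemma expectation_square_dist_diff_lower:
  assumes "prob_space M" and X: "X \<in> measurable M (count_space (verts G))"
    and total: "totally_defined G (law M X)" and u: "u \<in> verts G" and v: "v \<in> verts G"
  shows "graph_dist G u v * (graph_dist G u v - 2 * (\<integral>\<omega>. graph_dist G u (X \<omega>) \<partial>M))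
    \<le> (\<integral>\<omega>. (graph_dist G v (X \<omega>))\<^sup>2 \<partial>M) - (\<integral>\<omega>. (graph_dist G u (X \<omega>))\<^sup>2 \<partial>M)"
proof -
  interpret prob_space M by fact
  note sq = weight_law_eq_expectation(1)[OF assms(1-3)]
  have meas: "(\<lambda>\<omega>. graph_dist G u (X \<omega>)) \<in> borel_measurable M"
    by (rule measurable_compose[OF X]) simp
  have int: "integrable M (\<lambda>\<omega>. graph_dist G u (X \<omega>))"
    by (rule square_integrable_imp_integrable[OF meas sq[OF u]])
  have "(\<integral>\<omega>. graph_dist G u v * (graph_dist G u v - 2 * graph_dist G u (X \<omega>)) \<partial>M)
    \<le> (\<integral>\<omega>. (graph_dist G v (X \<omega>))\<^sup>2 - (graph_dist G u (X \<omega>))\<^sup>2 \<partial>M)"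
    using int sq u v measurable_space[OF X]
    by (intro integral_mono square_dist_diff_lower) auto
  then show ?thesis
    using int sq[OF u] sq[OF v] by (simp add: prob_space)
qed

lemma mean_set_iff:
  assumes "prob_space M" and "X \<in> measurable M (count_space (verts G))"
    and "totally_defined G (law M X)"
  shows "v \<in> mean_set G M X \<longleftrightarrow> v \<in> verts G \<and> (\<forall>u\<in>verts G.
    (\<integral>\<omega>. (graph_dist G v (X \<omega>))\<^sup>2 \<partial>M) \<le> (\<integral>\<omega>. (graph_dist G u (X \<omega>))\<^sup>2 \<partial>M))"
  by (auto simp: mean_set_def weight_minimizers_def weight_law_eq_expectation(2)[OF assms])

text \<open>
  Outside the ball around \<open>c\<close> whose radius is twice the expected distance from \<open>c\<close>, no weight is
  smaller than that of \<open>c\<close>. A minimum over this finite ball is therefore a global minimum.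
\<close>

lemma mean_set_nonempty:
  assumes "prob_space M" and X: "X \<in> measurable M (count_space (verts G))"
    and "totally_defined G (law M X)"
  shows "mean_set G M X \<noteq> {}"
proof -
  interpret prob_space M by fact
  define W where "W v = (\<integral>\<omega>. (graph_dist G v (X \<omega>))\<^sup>2 \<partial>M)" for v
  obtain c where c: "c \<in> verts G"
    using not_empty measurable_space[OF X] by auto
  let ?R = "2 * (\<integral>\<omega>. graph_dist G c (X \<omega>) \<partial>M)"
  \<comment> \<open>Inserting \<open>c\<close> saves a separate argument that the radius is nonnegative.\<close>
  let ?B = "insert c {v \<in> verts G. graph_dist G c v \<le> ?R}"
  have "finite ?B" using finite_graph_ball[OF c] by simp
  then have u: "arg_min_on W ?B \<in> ?B" "\<And>v. v \<in> ?B \<Longrightarrow> W (arg_min_on W ?B) \<le> W v"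
    by (rule arg_min_if_finite(1)[OF _ insert_not_empty], rule arg_min_least[OF _ insert_not_empty])
  define u where "u = arg_min_on W ?B"
  note u = u[folded u_def]
  have "W u \<le> W v" if v: "v \<in> verts G" for v
  proof (cases "v \<in> ?B")
    case False
    then have "0 \<le> graph_dist G c v * (graph_dist G c v - ?R)"
      using v graph_dist_nonneg[OF c v] by auto
    also have "\<dots> \<le> W v - W c"
      unfolding W_def by (rule expectation_square_dist_diff_lower[OF assms c v])
    finally show ?thesis using u(2)[of c] by simp
  qed (rule u(2))
  then have "u \<in> mean_set G M X"
    using u(1) c by (auto simp: mean_set_iff[OF assms] W_def)
  then show ?thesis by auto
qed

lemma sample_mean_set_le:
  assumes n: "n \<ge> 1" and x: "\<And>i. i \<in> {1..n} \<Longrightarrow> x i \<in> verts G"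
    and v: "v \<in> sample_mean_set G n x" and u: "u \<in> verts G"
  shows "(\<Sum>i=1..n. (graph_dist G v (x i))\<^sup>2 - (graph_dist G u (x i))\<^sup>2) \<le> 0"
proof -
  have "ennreal ((\<Sum>i=1..n. (graph_dist G v (x i))\<^sup>2) / real n)
      \<le> ennreal ((\<Sum>i=1..n. (graph_dist G u (x i))\<^sup>2) / real n)"
    using v u weight_sample_freq[of n x, OF x]
    by (simp add: sample_mean_set_def weight_minimizers_def)
  then have "(\<Sum>i=1..n. (graph_dist G v (x i))\<^sup>2) / real n
      \<le> (\<Sum>i=1..n. (graph_dist G u (x i))\<^sup>2) / real n"
    by (subst (asm) ennreal_le_iff) (auto intro!: divide_nonneg_nonneg sum_nonneg)
  then show ?thesis using n by (simp add: sum_subtractf divide_le_cancel)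
qed

text \<open>
  The bad event is covered by \<open>A\<close>, on which the mean distance from \<open>u\<close> is off by at least 1, and
  by one event \<open>E v\<close> for each \<open>v\<close> of the finite set \<open>B\<close>. Such a \<open>v\<close> has strictly larger weight
  than \<open>u\<close>, so to minimise the sample weight it needs a deviation by the whole difference
  \<open>\<delta> v\<close>, which is what \<open>E v\<close> records. The Chebyshev bounds of these events add up to the
  constant; it is formed from \<open>X\<close> alone, before the sequence is chosen.
\<close>

lemma sample_mean_set_not_subset_bound:
  assumes "prob_space M" and X: "X \<in> measurable M (count_space (verts G))"
    and total: "totally_defined G (law M X)"
  shows "\<exists>C::real. C > 0 \<and>
    (\<forall>\<xi>. iid M (count_space (verts G)) \<xi> \<and> \<xi> 1 = X \<longrightarrow>
      (\<forall>n\<ge>1. measure M {\<omega> \<in> space M.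
          \<not> sample_mean_set G n (\<lambda>i. \<xi> i \<omega>) \<subseteq> mean_set G M X} \<le> C / real n))"
proof -
  interpret prob_space M by fact
  note sq = weight_law_eq_expectation(1)[OF assms]
  have meas: "(\<lambda>\<omega>. h (X \<omega>)) \<in> borel_measurable M" for h :: "'a \<Rightarrow> real"
    by (rule measurable_compose[OF X]) simp
  have XV: "X \<omega> \<in> verts G" if "\<omega> \<in> space M" for \<omega>
    using measurable_space[OF X that] by simp
  obtain u where uE: "u \<in> mean_set G M X" using mean_set_nonempty[OF assms] by auto
  then have u: "u \<in> verts G" by (simp add: mean_set_iff[OF assms])
  define D where "D s = graph_dist G u s" for s
  define Y where "Y v s = (graph_dist G v s)\<^sup>2 - (graph_dist G u s)\<^sup>2" for v s
  define mD where "mD = expectation (\<lambda>\<omega>. D (X \<omega>))"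
  define \<delta> where "\<delta> v = expectation (\<lambda>\<omega>. Y v (X \<omega>))" for v
  \<comment> \<open>If the sample mean of \<open>D\<close> stays below \<open>mD + 1\<close>, all sample minimisers are within this radius.\<close>
  define R where "R = 2 * (mD + 1)"
  define B where "B = {v \<in> verts G. graph_dist G u v \<le> R} - mean_set G M X"
  \<comment> \<open>The summand 1 keeps the constant positive when all variances vanish.\<close>
  define C where "C = 1 + variance (\<lambda>\<omega>. D (X \<omega>)) + (\<Sum>v\<in>B. variance (\<lambda>\<omega>. Y v (X \<omega>)) / (\<delta> v)\<^sup>2)"
  have sqD: "integrable M (\<lambda>\<omega>. (D (X \<omega>))\<^sup>2)" using sq[OF u] by (simp add: D_def)
  have intD: "integrable M (\<lambda>\<omega>. D (X \<omega>))"
    by (rule square_integrable_imp_integrable[OF meas sqD])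
  have D0: "D s \<ge> 0" if "s \<in> verts G" for s
    using graph_dist_nonneg[OF u that] by (simp add: D_def)
  have "mD \<ge> 0"
    unfolding mD_def using D0 XV by (intro integral_nonneg_AE) auto
  then have R: "R > 0" by (simp add: R_def)
  have finB: "finite B" using finite_graph_ball[OF u] by (simp add: B_def)
  have BV: "v \<in> verts G" if "v \<in> B" for v using that by (simp add: B_def)
  have \<delta>: "\<delta> v > 0" if v: "v \<in> B" for v
  proof -
    have "\<delta> v = (\<integral>\<omega>. (graph_dist G v (X \<omega>))\<^sup>2 \<partial>M) - (\<integral>\<omega>. (graph_dist G u (X \<omega>))\<^sup>2 \<partial>M)"
      unfolding \<delta>_def Y_def by (rule Bochner_Integration.integral_diff[OF sq[OF BV[OF v]] sq[OF u]])
    moreover have "v \<notin> mean_set G M X" using v by (simp add: B_def)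
    then obtain w where "w \<in> verts G" 
      "(\<integral>\<omega>. (graph_dist G w (X \<omega>))\<^sup>2 \<partial>M) < (\<integral>\<omega>. (graph_dist G v (X \<omega>))\<^sup>2 \<partial>M)"
      using BV[OF v] by (auto simp: mean_set_iff[OF assms] not_le)
    moreover have "(\<integral>\<omega>. (graph_dist G u (X \<omega>))\<^sup>2 \<partial>M) \<le> (\<integral>\<omega>. (graph_dist G w (X \<omega>))\<^sup>2 \<partial>M)"
      using uE \<open>w \<in> verts G\<close> by (simp add: mean_set_iff[OF assms])
    ultimately show ?thesis by simp
  qed
  have sqY: "integrable M (\<lambda>\<omega>. (Y v (X \<omega>))\<^sup>2)" if v: "v \<in> verts G" for v
  proof (rule Bochner_Integration.integrable_bound)
    let ?r = "graph_dist G u v"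
    show "integrable M (\<lambda>\<omega>. (?r * (?r + 2 * D (X \<omega>)))\<^sup>2)"
      using intD sqD by (simp add: power_mult_distrib power2_sum)
    show "AE \<omega> in M. norm ((Y v (X \<omega>))\<^sup>2) \<le> norm ((?r * (?r + 2 * D (X \<omega>)))\<^sup>2)"
    proof (rule AE_I2)
      fix \<omega> assume "\<omega> \<in> space M"
      then have "\<bar>Y v (X \<omega>)\<bar> \<le> ?r * (?r + 2 * D (X \<omega>))"
        unfolding Y_def D_def by (intro square_dist_diff_bound u v XV)
      then have "(Y v (X \<omega>))\<^sup>2 \<le> (?r * (?r + 2 * D (X \<omega>)))\<^sup>2"
        by (metis abs_ge_zero power2_abs power_mono)
      then show "norm ((Y v (X \<omega>))\<^sup>2) \<le> norm ((?r * (?r + 2 * D (X \<omega>)))\<^sup>2)" by simp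
    qed
  qed (rule meas)
  have "C > 0"
    unfolding C_def by (intro add_pos_nonneg sum_nonneg divide_nonneg_nonneg variance_positive) auto
  moreover have "prob {\<omega> \<in> space M. \<not> sample_mean_set G n (\<lambda>i. \<xi> i \<omega>) \<subseteq> mean_set G M X} \<le> C / real n"
    if iid: "iid M (count_space (verts G)) \<xi>" and \<xi>1: "\<xi> 1 = X" and n: "n \<ge> 1" for \<xi> n
  proof -
    have rv: "\<xi> i \<in> measurable M (count_space (verts G))" if "i \<in> {1..n}" for i
      using iid that unfolding iid_def indep_vars_def by auto
    have \<xi>V: "\<xi> i \<omega> \<in> verts G" if "i \<in> {1..n}" "\<omega> \<in> space M" for i \<omega>
      using measurable_space[OF rv that(2)] that(1) by simp
    let ?avg = "\<lambda>h \<omega>. (\<Sum>i=1..n. h (\<xi> i \<omega>)) / real n"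
    let ?A = "{\<omega> \<in> space M. 1 \<le> \<bar>?avg D \<omega> - mD\<bar>}"
    let ?E = "\<lambda>v. {\<omega> \<in> space M. \<delta> v \<le> \<bar>?avg (Y v) \<omega> - \<delta> v\<bar>}"
    have avg_meas: "?avg h \<in> borel_measurable M" for h :: "'a \<Rightarrow> real"
      by (intro borel_measurable_divide borel_measurable_sum borel_measurable_const
          measurable_compose[OF rv]) auto
    have A: "?A \<in> events" and E: "\<And>v. ?E v \<in> events"
      by (intro borel_measurable_le borel_measurable_abs borel_measurable_diff
          borel_measurable_const avg_meas)+
    have cheb: "prob {\<omega> \<in> space M. a \<le> \<bar>?avg h \<omega> - expectation (\<lambda>\<omega>. h (X \<omega>))\<bar>}
        \<le> variance (\<lambda>\<omega>. h (X \<omega>)) / a\<^sup>2 / real n"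
      if "integrable M (\<lambda>\<omega>. (h (X \<omega>))\<^sup>2)" "a > 0" for a and h :: "'a \<Rightarrow> real"
      using iid_sample_mean_Chebyshev[OF iid _ _ n that(2), of h, unfolded \<xi>1] that(1) by simp
    have sub: "{\<omega> \<in> space M. \<not> sample_mean_set G n (\<lambda>i. \<xi> i \<omega>) \<subseteq> mean_set G M X}
        \<subseteq> ?A \<union> (\<Union>v\<in>B. ?E v)"
    proof
      fix \<omega> assume "\<omega> \<in> {\<omega> \<in> space M. \<not> sample_mean_set G n (\<lambda>i. \<xi> i \<omega>) \<subseteq> mean_set G M X}"
      then obtain v where \<omega>: "\<omega> \<in> space M" and v: "v \<in> sample_mean_set G n (\<lambda>i. \<xi> i \<omega>)"
        and vE: "v \<notin> mean_set G M X" by auto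
      have vV: "v \<in> verts G" using v by (simp add: sample_mean_set_def weight_minimizers_def)
      have le0: "(\<Sum>i=1..n. Y v (\<xi> i \<omega>)) \<le> 0"
        unfolding Y_def using sample_mean_set_le[OF n _ v u] \<xi>V[OF _ \<omega>] by blast
      show "\<omega> \<in> ?A \<union> (\<Union>v\<in>B. ?E v)"
      proof (cases "v \<in> B")
        case True
        \<comment> \<open>A mean of at most 0 deviates from the expectation \<open>\<delta> v\<close> by at least \<open>\<delta> v\<close>.\<close>
        have "?avg (Y v) \<omega> \<le> 0" using le0 by (simp add: divide_nonpos_nonneg)
        then have "\<omega> \<in> ?E v" using \<omega> \<delta>[OF True] by simp
        with True show ?thesis by blast
      next
        case False
        define r where "r = graph_dist G u v"
        have r: "r > R" using False vE vV by (auto simp: B_def r_def)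
        have "(\<Sum>i=1..n. r * (r - 2 * D (\<xi> i \<omega>))) \<le> (\<Sum>i=1..n. Y v (\<xi> i \<omega>))"
          unfolding r_def D_def Y_def
          by (intro sum_mono square_dist_diff_lower u vV \<xi>V[OF _ \<omega>])
        also have "(\<Sum>i=1..n. r * (r - 2 * D (\<xi> i \<omega>))) = r * (real n * (r - 2 * ?avg D \<omega>))"
          using n by (simp add: sum_distrib_left[symmetric] sum_subtractf field_simps)
        finally have "r * (real n * (r - 2 * ?avg D \<omega>)) \<le> 0" using le0 by simp
        then have "r - 2 * ?avg D \<omega> \<le> 0" using r R n by (simp add: mult_le_0_iff)
        then have "\<omega> \<in> ?A" using \<omega> r by (simp add: R_def)
        then show ?thesis by blast
      qed
    qed
    have "prob {\<omega> \<in> space M. \<not> sample_mean_set G n (\<lambda>i. \<xi> i \<omega>) \<subseteq> mean_set G M X}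
        \<le> prob (?A \<union> (\<Union>v\<in>B. ?E v))"
      using A E finB by (intro finite_measure_mono[OF sub]) auto
    also have "\<dots> \<le> prob ?A + prob (\<Union>v\<in>B. ?E v)"
      using A E finB by (intro measure_Un_le) auto
    also have "prob (\<Union>v\<in>B. ?E v) \<le> (\<Sum>v\<in>B. prob (?E v))"
      using E finB by (intro finite_measure_subadditive_finite) auto
    also have "prob ?A \<le> variance (\<lambda>\<omega>. D (X \<omega>)) / real n"
      using cheb[OF sqD, of 1] by (simp add: mD_def)
    also have "(\<Sum>v\<in>B. prob (?E v)) \<le> (\<Sum>v\<in>B. variance (\<lambda>\<omega>. Y v (X \<omega>)) / (\<delta> v)\<^sup>2 / real n)"
      using cheb[OF sqY[OF BV] \<delta>] by (intro sum_mono) (simp add: \<delta>_def)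
    also have "variance (\<lambda>\<omega>. D (X \<omega>)) / real n + \<dots> \<le> C / real n"
      by (simp add: C_def sum_divide_distrib add_divide_distrib)
    finally show ?thesis by simp
  qed
  ultimately show ?thesis
    by (intro exI[of _ C]) simp
qed

end

theorem theoremC:
  fixes G :: "('a, 'b) pre_digraph"
    and M :: "'o measure"
    and X :: "'o \<Rightarrow> 'a"
  assumes "prob_space M"
    and "sym_digraph G"
    and "Digraph_Component.connected G"
    and "locally_finite G"
    and "X \<in> measurable M (count_space (verts G))"
    and "totally_defined G (law M X)"
  shows "\<exists>C::real. C > 0 \<and>
    (\<forall>\<xi>. iid M (count_space (verts G)) \<xi> \<and> \<xi> 1 = X \<longrightarrow>
      (\<forall>n\<ge>1. measure M {\<omega> \<in> space M.
          \<not> sample_mean_set G n (\<lambda>i. \<xi> i \<omega>) \<subseteq> mean_set G M X} \<le> C / real n))"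
proof -
  interpret sym_digraph G by fact
  interpret connected_locally_finite_graph G
    by unfold_locales fact+
  show ?thesis
    by (rule sample_mean_set_not_subset_bound) fact+
qed

end
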